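(* There exists a Sidon set of size $552$ in $\mathbb{F}_2^{19}$.
   Context: A subset $M\subseteq\mathbb{F}_2^t$ is called a Sidon set if $m_1+m_2\neq m_3+m_4$ for all pairwise distinct $m_1,m_2,m_3,m_4\in M$; equivalently, the sum of any four distinct elements of $M$ is different from $0$. *)

theory Defs
  imports "HOL-Analysis.Finite_Cartesian_Product" "HOL-Library.Z2" "HOL-Library.Numeral_Type"
begin

text \<open>The space \<open>F\<^sub>2\<^sup>t\<close> is \<^typ>\<open>bit ^ 't\<close>, where \<^typ>\<open>bit\<close> is the two-element field of
  \<^theory>\<open>HOL-Library.Z2\<close> and the finite index type \<open>'t\<close> has \<open>t\<close> elements; addition is
  componentwise.\<close>

definition sidon_set :: "(bit ^ 't::finite) set \<Rightarrow> bool" where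
  "sidon_set M \<longleftrightarrow>
     (\<forall>m1\<in>M. \<forall>m2\<in>M. \<forall>m3\<in>M. \<forall>m4\<in>M. distinct [m1, m2, m3, m4] \<longrightarrow> m1 + m2 \<noteq> m3 + m4)"

end

(*
  Idea. If F is an almost perfect nonlinear (APN) function on the field with 1024 elements, its graph
  {(x, F x)} is a Sidon set in F_2^20, and so is its intersection with an affine hyperplane,
  which lives in F_2^19.  For a power function F x = x^d, multiplication by a primitive element
  permutes the graph; hence a relation between two pairs of points can be scaled so that the first
  coordinates of each pair differ by a fixed vector, and only the 511 differences F (x + 1) + F x
  have to be compared.  For the Dobbertin exponent d = 339 a hyperplane meets the graph in 552
  points.  No field arithmetic is needed: in suitable bases, multiplication by a primitive
  element and by its 339-th power are linear feedback shift registers.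
*)
theory Submission
  imports Defs
begin

section \<open>Bit strings and Sidon sets\<close>

definition xor_list :: "bool list \<Rightarrow> bool list \<Rightarrow> bool list" where
  "xor_list v w = map2 (\<noteq>) v w"

lemma length_xor_list [simp]: "length (xor_list v w) = min (length v) (length w)"
  by (simp add: xor_list_def)

lemma nth_xor_list [simp]:
  "k < length v \<Longrightarrow> k < length w \<Longrightarrow> xor_list v w ! k \<longleftrightarrow> v ! k \<noteq> w ! k"
  by (simp add: xor_list_def)

lemma xor_list_Nil [simp]: "xor_list [] [] = []"
  by (simp add: xor_list_def)

lemma xor_list_Cons [simp]: "xor_list (a # v) (b # w) = (a \<noteq> b) # xor_list v w"
  by (simp add: xor_list_def)

lemma xor_list_append:
  "length v = length v' \<Longrightarrow> xor_list (v @ w) (v' @ w') = xor_list v v' @ xor_list w w'"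
  by (simp add: xor_list_def)

lemma tl_xor_list: "length v = length w \<Longrightarrow> tl (xor_list v w) = xor_list (tl v) (tl w)"
  by (cases v; cases w) (auto simp: xor_list_def)

lemma xor_list_commute: "length v = length w \<Longrightarrow> xor_list v w = xor_list w v"
  by (rule nth_equalityI) auto

lemma xor_list_eq_zero_iff:
  "length v = length w \<Longrightarrow> xor_list v w = replicate (length v) False \<longleftrightarrow> v = w"
  by (auto simp: list_eq_iff_nth_eq)

text \<open>Bit lists can be evaluated; a numbering of the coordinates carries them over to
  vectors.\<close>

lemma sidon_set_of_bool_lists:
  fixes S :: "bool list set"
  assumes len: "\<And>w. w \<in> S \<Longrightarrow> length w = CARD('n::finite)"
    and sidon: "\<And>a b c d. \<lbrakk>a \<in> S; b \<in> S; c \<in> S; d \<in> S; xor_list a b = xor_list c d\<rbrakk>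
      \<Longrightarrow> a = b \<or> {a, b} = {c, d}"
  shows "\<exists>M :: (bit ^ 'n) set. sidon_set M \<and> card M = card S"
proof -
  obtain h :: "'n \<Rightarrow> nat" where h: "bij_betw h UNIV {..<CARD('n)}"
    using ex_bij_betw_finite_nat[of "UNIV :: 'n set"] by (auto simp: atLeast0LessThan)
  then have h_lt: "h c < CARD('n)" for c
    by (auto simp: bij_betw_def)
  have h_surj: "\<exists>c. k = h c" if "k < CARD('n)" for k
    using that h by (auto simp: bij_betw_def)
  define emb :: "bool list \<Rightarrow> bit ^ 'n" where "emb w = (\<chi> c. of_bool (w ! h c))" for w
  have emb_sum: "xor_list a b = xor_list c d"
    if "emb a + emb b = emb c + emb d" "a \<in> S" "b \<in> S" "c \<in> S" "d \<in> S" for a b c d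
  proof (rule nth_equalityI)
    show "length (xor_list a b) = length (xor_list c d)"
      using that len by simp
    fix k assume "k < length (xor_list a b)"
    then have k: "k < CARD('n)"
      using that len by simp
    then obtain i where i: "k = h i"
      using h_surj by blast
    have "(emb a + emb b) $ i = (emb c + emb d) $ i"
      using that by simp
    then have "(a ! k \<noteq> b ! k) = (c ! k \<noteq> d ! k)"
      by (simp add: emb_def i of_bool_def split: if_splits)
    then show "xor_list a b ! k = xor_list c d ! k"
      using that len k by simp
  qed
  have inj: "inj_on emb S"
  proof (rule inj_onI)
    fix a b assume ab: "a \<in> S" "b \<in> S" "emb a = emb b"
    \<comment> \<open>Injectivity is the degenerate instance
      \<open>emb a + emb b = emb b + emb b\<close>.\<close>
    then have "xor_list a b = xor_list b b"
      using emb_sum[of a b b b] by simp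
    also have "\<dots> = replicate (length b) False"
      by (simp add: xor_list_eq_zero_iff)
    finally show "a = b"
      using xor_list_eq_zero_iff[of a b] len ab by simp
  qed
  have "sidon_set (emb ` S)"
    unfolding sidon_set_def
  proof (intro ballI impI notI)
    fix m1 m2 m3 m4
    assume m: "m1 \<in> emb ` S" "m2 \<in> emb ` S" "m3 \<in> emb ` S" "m4 \<in> emb ` S"
      and dist: "distinct [m1, m2, m3, m4]" and eq: "m1 + m2 = m3 + m4"
    from m obtain a b c d where "a \<in> S" "b \<in> S" "c \<in> S" "d \<in> S"
      and e: "m1 = emb a" "m2 = emb b" "m3 = emb c" "m4 = emb d"
      by blast
    then have "a = b \<or> {a, b} = {c, d}"
      using emb_sum sidon eq by blast
    with dist e show False
      by (auto simp: doubleton_eq_iff)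
  qed
  with inj show ?thesis
    by (auto simp: card_image)
qed

section \<open>Linear feedback shift registers\<close>

text \<open>For distinct taps below n, the length of \<open>w\<close>, this is the companion matrix
  of X^n + sum of X^k over the taps k.\<close>

definition shift :: "nat list \<Rightarrow> bool list \<Rightarrow> bool list" where
  "shift taps w = tl w @ [fold (\<lambda>k b. b \<noteq> w ! k) taps False]"

lemma length_shift [simp]: "w \<noteq> [] \<Longrightarrow> length (shift taps w) = length w"
  by (simp add: shift_def)

text \<open>Parity is additive; arbitrary accumulators \<open>p\<close> and \<open>q\<close> let the
  induction go through.\<close>

lemma fold_taps_xor_list:
  assumes "length v = length w" "set taps \<subseteq> {..<length w}"
  shows "fold (\<lambda>k b. b \<noteq> xor_list v w ! k) taps (p \<noteq> q) \<longleftrightarrow>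
    fold (\<lambda>k b. b \<noteq> v ! k) taps p \<noteq> fold (\<lambda>k b. b \<noteq> w ! k) taps q"
  using assms
proof (induction taps arbitrary: p q)
  case (Cons k taps)
  have "((p \<noteq> q) \<noteq> xor_list v w ! k) = ((p \<noteq> v ! k) \<noteq> (q \<noteq> w ! k))"
    using Cons.prems by auto
  then show ?case
    using Cons.IH[of "p \<noteq> v ! k" "q \<noteq> w ! k"] Cons.prems by simp
qed simp

lemma shift_xor_list:
  assumes "length v = length w" "set taps \<subseteq> {..<length w}"
  shows "shift taps (xor_list v w) = xor_list (shift taps v) (shift taps w)"
  using fold_taps_xor_list[OF assms, of False False] assms
  by (simp add: shift_def tl_xor_list xor_list_append)

lemma length_shift_funpow [simp]: "w \<noteq> [] \<Longrightarrow> length ((shift taps ^^ n) w) = length w"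
  by (induction n) (simp_all flip: length_greater_0_conv)

lemma shift_funpow_xor_list:
  assumes "length v = length w" "w \<noteq> []" "set taps \<subseteq> {..<length w}"
  shows "(shift taps ^^ n) (xor_list v w) = xor_list ((shift taps ^^ n) v) ((shift taps ^^ n) w)"
proof (induction n)
  case (Suc n)
  moreover have "v \<noteq> []"
    using assms by auto
  ultimately show ?case
    using assms by (simp add: shift_xor_list)
qed simp

section \<open>Evaluation by radix partition\<close>

text \<open>Passing the state on costs only one application of \<open>f\<close> per entry.\<close>

fun orbit :: "nat \<Rightarrow> ('a \<Rightarrow> 'a) \<Rightarrow> 'a \<Rightarrow> 'a list" where
  "orbit 0 f x = []"
| "orbit (Suc n) f x = x # orbit n f (f x)"

lemma orbit_eq_map: "orbit n f x = map (\<lambda>i. (f ^^ i) x) [0..<n]"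
proof (induction n arbitrary: x)
  case (Suc n)
  have "[0..<Suc n] = 0 # map Suc [0..<n]"
    by (simp add: map_Suc_upt upt_conv_Cons del: upt_Suc)
  then show ?case
    by (simp add: Suc.IH funpow_swap1 del: upt_Suc)
qed simp

lemma map_prod_funpow:
  fixes f :: "'a \<Rightarrow> 'a" and g :: "'b \<Rightarrow> 'b"
  shows "(map_prod f g ^^ n) (x, y) = ((f ^^ n) x, (g ^^ n) y)"
  by (induction n) auto

text \<open>The equations avoid \<open>if\<close> because \<open>code_simp\<close> retraverses the branches of a
  conditional, which would make the evaluation quadratic in the length of the list.\<close>
fun branch :: "bool \<Rightarrow> (bool list \<times> 'a) list \<Rightarrow> (bool list \<times> 'a) list" where
  "branch b [] = []"
| "branch False ((False # w, p) # ps) = (w, p) # branch False ps"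
| "branch False ((True # w, p) # ps) = branch False ps"
| "branch True ((False # w, p) # ps) = branch True ps"
| "branch True ((True # w, p) # ps) = (w, p) # branch True ps"
| "branch b (([], p) # ps) = branch b ps"

lemma mem_branch: "(b # w, p) \<in> set ps \<Longrightarrow> (w, p) \<in> set (branch b ps)"
  by (induction b ps rule: branch.induct) auto

text \<open>Each level splits both lists on one key bit, so a leaf pairs only entries whose first
  \<open>d\<close> key bits agree.\<close>

fun join :: "nat \<Rightarrow> (bool list \<times> 'a) list \<Rightarrow> (bool list \<times> 'b) list \<Rightarrow> ('a \<times> 'b) list" where
  "join 0 ps qs = List.product (map snd ps) (map snd qs)"
| "join (Suc d) ps qs =
     join d (branch False ps) (branch False qs) @ join d (branch True ps) (branch True qs)"

lemma mem_join:
  "(w, p) \<in> set ps \<Longrightarrow> (w, q) \<in> set qs \<Longrightarrow> length w = d \<Longrightarrow> (p, q) \<in> set (join d ps qs)"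
proof (induction d arbitrary: w ps qs)
  case 0
  then show ?case by force
next
  case (Suc d)
  then obtain b v where "w = b # v" "length v = d"
    by (cases w) auto
  with Suc.prems have "(p, q) \<in> set (join d (branch b ps) (branch b qs))"
    by (intro Suc.IH[of v]) (auto intro: mem_branch)
  then show ?case
    by (cases b) auto
qed

fun unique_keys :: "nat \<Rightarrow> (bool list \<times> 'a) list \<Rightarrow> bool" where
  "unique_keys 0 ps \<longleftrightarrow> (case ps of [] \<Rightarrow> True | p # qs \<Rightarrow> qs = [])"
| "unique_keys (Suc d) ps \<longleftrightarrow> unique_keys d (branch False ps) \<and> unique_keys d (branch True ps)"

lemma unique_keysD:
  "unique_keys d ps \<Longrightarrow> (w, p) \<in> set ps \<Longrightarrow> (w, q) \<in> set ps \<Longrightarrow> length w = d \<Longrightarrow> p = q"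
proof (induction d arbitrary: w ps)
  case 0
  then show ?case by (auto split: list.splits)
next
  case (Suc d)
  then obtain b v where v: "w = b # v" "length v = d"
    by (cases w) auto
  with Suc.prems have "unique_keys d (branch b ps)"
    by (cases b) auto
  then show ?case
    using Suc.prems v by (intro Suc.IH[of "branch b ps" v]) (auto intro: mem_branch)
qed

section \<open>The graph of the Dobbertin function\<close>

text \<open>The taps are the exponents in the minimal polynomials of a primitive element \<open>\<alpha>\<close>, which is
  \<open>X^10 + X^9 + X^4 + X^2 + 1\<close>, and of \<open>\<alpha>^339\<close>, which is \<open>X^10 + X^3 + X^2 + X + 1\<close>.\<close>
definition step_x :: "bool list \<Rightarrow> bool list" where
  "step_x = shift [0, 2, 4, 9]"

definition step_y :: "bool list \<Rightarrow> bool list" where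
  "step_y = shift [0, 1, 2, 3]"

text \<open>Two states differ by this unit vector exactly if they differ only in the head, so
  partners are found by a split on the first bit and a join on the other nine.\<close>

definition seed_x :: "bool list" where
  "seed_x = [True, False, False, False, False, False, False, False, False, False]"

text \<open>The choice of this seed amounts to a choice of basis for the second coordinate; it makes
  \<open>hd x \<noteq> hd y\<close> a hyperplane that meets the graph in 552 points.\<close>
definition seed_y :: "bool list" where
  "seed_y = [True, True, True, True, True, True, True, True, True, False]"

definition x_at :: "nat \<Rightarrow> bool list" where
  "x_at n = (step_x ^^ n) seed_x"

definition y_at :: "nat \<Rightarrow> bool list" where
  "y_at n = (step_y ^^ n) seed_y"

text \<open>The graph without its point (0, 0), which lies off the hyperplane
  \<open>hd x \<noteq> hd y\<close>.\<close>

definition points :: "(bool list \<times> bool list) list" where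
  "points = orbit 1023 (map_prod step_x step_y) (seed_x, seed_y)"

lemma orbit_seeds:
  "orbit n (map_prod step_x step_y) (seed_x, seed_y) = map (\<lambda>i. (x_at i, y_at i)) [0..<n]"
  by (simp add: orbit_eq_map map_prod_funpow x_at_def y_at_def)

lemma points_eq: "points = map (\<lambda>i. (x_at i, y_at i)) [0..<1023]"
  unfolding points_def by (rule orbit_seeds)

text \<open>Nesting 1023 = 33 * 31 keeps the evaluated exponents small.\<close>

lemma period_points: "((map_prod step_x step_y ^^ 33) ^^ 31) (seed_x, seed_y) = (seed_x, seed_y)"
  by code_simp

text \<open>This excludes an earlier return to \<open>seed_x\<close>, so that the first register has
  period exactly 1023.\<close>

lemma count_bad_points:
  "(\<Sum>(x, y)\<leftarrow>tl points. of_bool (x = seed_x \<or> x = replicate 10 False) :: nat) = 0"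
  by code_simp

lemma count_hyperplane: "(\<Sum>(x, y)\<leftarrow>points. of_bool (hd x \<noteq> hd y) :: nat) = 552"
  by code_simp

text \<open>The lists \<open>x\<close> and \<open>x'\<close> that are joined here differ by \<^const>\<open>seed_x\<close>, and each
  difference of the corresponding \<open>y\<close> determines the pair \<open>(x, x')\<close>.\<close>
lemma unique_differences:
  "let ps = map (\<lambda>(x, y). (x, (x, y))) points
   in unique_keys 10 (map (\<lambda>((x, y), (x', y')). (xor_list y y', (x, x')))
        (join 9 (branch False ps) (branch True ps)))"
  by code_simp

section \<open>Periods of the registers and primitivity of the first one\<close>

lemma length_x_at [simp]: "length (x_at n) = 10"
  by (simp add: x_at_def step_x_def seed_x_def)

lemma length_y_at [simp]: "length (y_at n) = 10"
  by (simp add: y_at_def step_y_def seed_y_def)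

lemma x_at_add: "x_at (m + n) = (step_x ^^ m) (x_at n)"
  by (simp add: x_at_def funpow_add)

lemma y_at_add: "y_at (m + n) = (step_y ^^ m) (y_at n)"
  by (simp add: y_at_def funpow_add)

lemma step_x_funpow_xor_list:
  "length v = 10 \<Longrightarrow> length w = 10 \<Longrightarrow>
    (step_x ^^ n) (xor_list v w) = xor_list ((step_x ^^ n) v) ((step_x ^^ n) w)"
  unfolding step_x_def by (rule shift_funpow_xor_list) auto

lemma step_y_funpow_xor_list:
  "length v = 10 \<Longrightarrow> length w = 10 \<Longrightarrow>
    (step_y ^^ n) (xor_list v w) = xor_list ((step_y ^^ n) v) ((step_y ^^ n) w)"
  unfolding step_y_def by (rule shift_funpow_xor_list) auto

lemma seed_period: "x_at 1023 = seed_x" "y_at 1023 = seed_y"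
proof -
  have "(1023 :: nat) = 33 * 31"
    by simp
  then have "map_prod step_x step_y ^^ 1023 = (map_prod step_x step_y ^^ 33) ^^ 31"
    by (simp only: funpow_mult)
  then have "(map_prod step_x step_y ^^ 1023) (seed_x, seed_y) = (seed_x, seed_y)"
    by (simp only: period_points)
  then show "x_at 1023 = seed_x" "y_at 1023 = seed_y"
    by (simp_all only: map_prod_funpow x_at_def y_at_def prod.inject)
qed

lemma x_at_period: "x_at (n + 1023) = x_at n"
  by (simp only: x_at_add seed_period) (simp only: x_at_def)

lemma y_at_period: "y_at (n + 1023) = y_at n"
  by (simp only: y_at_add seed_period) (simp only: y_at_def)

lemma at_mod: "x_at (n mod 1023) = x_at n \<and> y_at (n mod 1023) = y_at n"
proof (induction n rule: less_induct)
  case (less n)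
  show ?case
  proof (cases "n < 1023")
    case False
    then have "n = (n - 1023) + 1023"
      by simp
    moreover have "n mod 1023 = (n - 1023) mod 1023"
      using False by (simp add: le_mod_geq)
    ultimately show ?thesis
      using less[of "n - 1023"] False x_at_period[of "n - 1023"] y_at_period[of "n - 1023"]
      by simp
  qed simp
qed

lemma at_in_points: "(x_at n, y_at n) \<in> set points"
proof -
  have "n mod 1023 \<in> set [0..<1023]"
    unfolding set_upt by simp
  then have "(x_at (n mod 1023), y_at (n mod 1023)) \<in> set points"
    unfolding points_eq set_map by (rule imageI)
  then show ?thesis
    by (simp only: at_mod)
qed

lemma x_at_not_seed: "0 < n \<Longrightarrow> n < 1023 \<Longrightarrow> x_at n \<noteq> seed_x"
  and x_at_nonzero: "x_at n \<noteq> replicate 10 False"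
proof -
  have tl_points: "tl points = map (\<lambda>i. (x_at i, y_at i)) [1..<1023]"
    unfolding points_eq map_tl[symmetric] tl_upt by simp
  have bad: "x_at n \<noteq> seed_x \<and> x_at n \<noteq> replicate 10 False" if "0 < n" "n < 1023" for n
  proof -
    have "n \<in> set [1..<1023]"
      unfolding set_upt using that by simp
    then have "(x_at n, y_at n) \<in> set (tl points)"
      unfolding tl_points set_map by (rule imageI)
    then have "of_bool (x_at n = seed_x \<or> x_at n = replicate 10 False) = (0 :: nat)"
      using count_bad_points by (force simp only: sum_list_eq_0_iff set_map)
    then show ?thesis
      by simp
  qed
  then show "0 < n \<Longrightarrow> n < 1023 \<Longrightarrow> x_at n \<noteq> seed_x"
    by blast
  show "x_at n \<noteq> replicate 10 False"
  proof (cases "n mod 1023 = 0")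
    case True
    then have "x_at n = x_at 0"
      using at_mod[of n] by simp
    then show ?thesis
      by (simp add: x_at_def seed_x_def numeral_eq_Suc)
  next
    case False
    then show ?thesis
      using bad[of "n mod 1023"] at_mod[of n] by simp
  qed
qed

lemma inj_x_at: "inj_on x_at {..<1023}"
proof (rule linorder_inj_onI')
  fix i j :: nat assume ij: "i \<in> {..<1023}" "j \<in> {..<1023}" "i < j"
  show "x_at i \<noteq> x_at j"
  proof
    assume "x_at i = x_at j"
    \<comment> \<open>Advancing a repetition to the end of the period gives a return to the seed
      strictly between 0 and 1023.\<close>
    then have "x_at (1023 - j + i) = x_at (1023 - j + j)"
      by (simp only: x_at_add)
    also have "1023 - j + j = 1023"
      using ij by simp
    finally have "x_at (1023 - j + i) = seed_x"
      by (simp only: seed_period)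
    moreover have "x_at (1023 - j + i) \<noteq> seed_x"
      using ij by (intro x_at_not_seed) auto
    ultimately show False
      by contradiction
  qed
qed

text \<open>Counting: the 1023 distinct nonzero states exhaust the 2^10 - 1 nonzero lists.\<close>

lemma x_at_surj:
  assumes "length w = 10" "w \<noteq> replicate 10 False"
  obtains m where "m < 1023" "x_at m = w"
proof -
  define W :: "bool list set" where "W = {w. set w \<subseteq> UNIV \<and> length w = 10}"
  have W: "finite W" "card W = 1024"
    unfolding W_def
    using finite_lists_length_eq[of "UNIV :: bool set" 10] card_lists_length_eq[of "UNIV :: bool set" 10]
    by simp_all
  have "x_at ` {..<1023} = W - {replicate 10 False}"
  proof (rule card_subset_eq)
    show "finite (W - {replicate 10 False})"
      using W by simp
    show "x_at ` {..<1023} \<subseteq> W - {replicate 10 False}"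
      using x_at_nonzero by (auto simp: W_def)
    have "replicate 10 False \<in> W"
      by (simp add: W_def)
    then show "card (x_at ` {..<1023}) = card (W - {replicate 10 False})"
      using W by (simp add: card_image inj_x_at)
  qed
  moreover have "w \<in> W - {replicate 10 False}"
    using assms by (simp add: W_def)
  ultimately have "w \<in> x_at ` {..<1023}"
    by (simp only:)
  then obtain m where "w = x_at m" "m \<in> {..<1023}"
    by (rule imageE)
  then show thesis
    by (intro that) simp_all
qed

section \<open>The Sidon property of the graph\<close>

lemma unique_differences_at:
  assumes "x_at i = False # t" "x_at j = True # t" "x_at k = False # u" "x_at l = True # u"
    and "xor_list (y_at i) (y_at j) = xor_list (y_at k) (y_at l)"
  shows "x_at i = x_at k \<and> x_at j = x_at l"
proof -
  define ps where "ps = map (\<lambda>(x, y). (x, (x, y))) points"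
  define ds where "ds = map (\<lambda>((x, y), (x', y')). (xor_list y y', (x, x')))
    (join 9 (branch False ps) (branch True ps))"
  have ps: "(x_at n, (x_at n, y_at n)) \<in> set ps" for n
    using at_in_points[of n] by (force simp: ps_def)
  have ds: "(xor_list (y_at i) (y_at j), (x_at i, x_at j)) \<in> set ds"
    if "x_at i = False # t" "x_at j = True # t" for i j t
  proof -
    have "(t, (x_at i, y_at i)) \<in> set (branch False ps)" "(t, (x_at j, y_at j)) \<in> set (branch True ps)"
      using ps[of i] ps[of j] that by (auto intro: mem_branch)
    moreover have "length t = 9"
      using that length_x_at[of i] by simp
    ultimately show ?thesis
      unfolding ds_def by (force dest: mem_join)
  qed
  have "unique_keys 10 ds"
    using unique_differences by (simp only: ds_def ps_def Let_def)
  then show ?thesis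
    using unique_keysD[of 10 ds "xor_list (y_at i) (y_at j)"] ds assms
    by (metis length_xor_list length_y_at min.idem prod.inject)
qed

lemma xor_list_eq_seed_x:
  assumes "xor_list v w = seed_x" "length v = 10" "length w = 10"
  obtains t where "{v, w} = {False # t, True # t}"
proof -
  obtain a t where v: "v = a # t" "length t = 9"
    using assms(2) by (cases v) auto
  obtain b u where w: "w = b # u" "length u = 9"
    using assms(3) by (cases w) auto
  then have "a \<noteq> b" "xor_list t u = replicate (length t) False"
    using assms(1) v w by (auto simp: seed_x_def numeral_eq_Suc)
  then have "t = u"
    using v w xor_list_eq_zero_iff by metis
  with v w \<open>a \<noteq> b\<close> show thesis
    by (intro that[of t]) (cases a; cases b; auto)+
qed

lemma apn_at_seed:
  assumes "xor_list (x_at i) (x_at j) = seed_x" "xor_list (x_at k) (x_at l) = seed_x"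
    and "xor_list (y_at i) (y_at j) = xor_list (y_at k) (y_at l)"
  shows "{x_at i, x_at j} = {x_at k, x_at l}"
proof -
  \<comment> \<open>The join lists each pair with the \<open>False\<close> head first; differences
    are symmetric, so any pair can be put in that order.\<close>
  have ordered: "\<exists>i' j' t. x_at i' = False # t \<and> x_at j' = True # t \<and> {x_at i, x_at j} = {x_at i', x_at j'} \<and>
      xor_list (y_at i) (y_at j) = xor_list (y_at i') (y_at j')"
    if eq: "xor_list (x_at i) (x_at j) = seed_x" for i j
  proof -
    obtain t where "{x_at i, x_at j} = {False # t, True # t}"
      by (rule xor_list_eq_seed_x[OF eq length_x_at length_x_at])
    then consider "x_at i = False # t" "x_at j = True # t" | "x_at j = False # t" "x_at i = True # t"
      by (auto simp: doubleton_eq_iff)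
    then show ?thesis
    proof cases
      case 1
      then show ?thesis by blast
    next
      case 2
      then show ?thesis
        using xor_list_commute[of "y_at i" "y_at j"] by (metis insert_commute length_y_at)
    qed
  qed
  from ordered[OF assms(1)] ordered[OF assms(2)] show ?thesis
    using assms(3) unique_differences_at by metis
qed

text \<open>The x difference is nonzero, hence some \<open>x_at m\<close>. Running both registers
  1023 - m steps further turns it into \<open>seed_x\<close> and, by linearity, preserves both
  equations.\<close>

lemma graph_sidon:
  assumes x: "xor_list (x_at i) (x_at j) = xor_list (x_at k) (x_at l)"
    and y: "xor_list (y_at i) (y_at j) = xor_list (y_at k) (y_at l)"
    and "x_at i \<noteq> x_at j"
  shows "{x_at i, x_at j} = {x_at k, x_at l}"
proof -
  have "xor_list (x_at i) (x_at j) \<noteq> replicate 10 False"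
    using assms xor_list_eq_zero_iff[of "x_at i" "x_at j"] by simp
  then obtain m where m: "m < 1023" "x_at m = xor_list (x_at i) (x_at j)"
    using x_at_surj[of "xor_list (x_at i) (x_at j)"] by auto
  define c where "c = 1023 - m"
  have "x_at (c + m) = seed_x"
    using m by (simp add: c_def seed_period)
  then have "xor_list (x_at (c + i)) (x_at (c + j)) = seed_x"
    using m by (simp add: x_at_add step_x_funpow_xor_list)
  moreover have "xor_list (x_at (c + k)) (x_at (c + l)) = xor_list (x_at (c + i)) (x_at (c + j))"
    using x by (simp add: x_at_add flip: step_x_funpow_xor_list)
  moreover have "xor_list (y_at (c + i)) (y_at (c + j)) = xor_list (y_at (c + k)) (y_at (c + l))"
    using y by (simp add: y_at_add flip: step_y_funpow_xor_list)
  ultimately have "{x_at (c + i), x_at (c + j)} = {x_at (c + k), x_at (c + l)}"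
    by (intro apn_at_seed) auto
  \<comment> \<open>Another \<open>m\<close> steps complete the period and undo the scaling.\<close>
  then have "(step_x ^^ m) ` {x_at (c + i), x_at (c + j)} = (step_x ^^ m) ` {x_at (c + k), x_at (c + l)}"
    by (rule arg_cong)
  moreover have "(step_x ^^ m) (x_at (c + n)) = x_at n" for n
    using x_at_period[of n] m by (simp add: c_def algebra_simps flip: x_at_add)
  ultimately show ?thesis
    by simp
qed

section \<open>The hyperplane section in dimension 19\<close>

theorem theorem4p4:
  shows "\<exists>M :: (bit ^ 19) set. sidon_set M \<and> card M = 552"
proof -
  define I where "I = {i \<in> {..<1023}. hd (x_at i) \<noteq> hd (y_at i)}"
  define p where "p i = x_at i @ tl (y_at i)" for i
  have y_Cons: "y_at i = (\<not> hd (x_at i)) # tl (y_at i)" if "i \<in> I" for i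
    using that length_y_at[of i] by (cases "y_at i") (auto simp: I_def)
  have "card I = (\<Sum>i<1023. of_bool (hd (x_at i) \<noteq> hd (y_at i)))"
    unfolding I_def by (simp add: of_bool_def sum.If_cases Int_def)
  also have "\<dots> = (\<Sum>(x, y)\<leftarrow>points. of_bool (hd x \<noteq> hd y))"
    unfolding points_eq map_map comp_def prod.case interv_sum_list_conv_sum_set_nat
      set_upt atLeast0LessThan ..
  finally have "card I = 552"
    by (simp only: count_hyperplane)
  moreover have "inj_on p I"
    using inj_x_at by (auto simp: inj_on_def p_def I_def)
  ultimately have card: "card (p ` I) = 552"
    by (simp add: card_image)
  have "\<exists>M :: (bit ^ 19) set. sidon_set M \<and> card M = card (p ` I)"
  proof (rule sidon_set_of_bool_lists)
    show "length w = CARD(19)" if "w \<in> p ` I" for w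
      using that by (auto simp: p_def)
    fix a b c d
    assume "a \<in> p ` I" "b \<in> p ` I" "c \<in> p ` I" "d \<in> p ` I" and eq: "xor_list a b = xor_list c d"
    then obtain i j k l where ijkl: "i \<in> I" "j \<in> I" "k \<in> I" "l \<in> I"
      and abcd: "a = p i" "b = p j" "c = p k" "d = p l"
      by blast
    from eq have x: "xor_list (x_at i) (x_at j) = xor_list (x_at k) (x_at l)"
      and tl: "xor_list (tl (y_at i)) (tl (y_at j)) = xor_list (tl (y_at k)) (tl (y_at l))"
      by (simp_all add: abcd p_def xor_list_append)
    have hd: "hd (xor_list (x_at i) (x_at j)) = (hd (x_at i) \<noteq> hd (x_at j))" for i j
      using length_x_at[of i] length_x_at[of j] by (cases "x_at i"; cases "x_at j") auto
    \<comment> \<open>Negating both heads preserves their difference, so the first bit of the x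
      equation restores the dropped bit of the y equation.\<close>
    have "(hd (x_at i) \<noteq> hd (x_at j)) = (hd (x_at k) \<noteq> hd (x_at l))"
      using x hd by metis
    then have y: "xor_list (y_at i) (y_at j) = xor_list (y_at k) (y_at l)"
      using ijkl tl by (subst (1 2 3 4) y_Cons) auto
    show "a = b \<or> {a, b} = {c, d}"
    proof (cases "x_at i = x_at j")
      case True
      then have "i = j"
        using ijkl inj_x_at by (auto simp: inj_on_def I_def)
      then show ?thesis
        by (simp add: abcd)
    next
      case False
      then have "{x_at i, x_at j} = {x_at k, x_at l}"
        using graph_sidon x y by blast
      then have "{i, j} = {k, l}"
        using ijkl inj_x_at unfolding doubleton_eq_iff inj_on_def I_def by blast
      then show ?thesis
        by (auto simp: abcd doubleton_eq_iff)
    qed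
  qed
  then show ?thesis
    by (simp only: card)
qed

end
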